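(* In terms of selecting a generating distribution $\mathbb P_0$ to minimize $M(\mathbb P_0,\{\mathbb Q: d_\phi(\mathbb P_{\hat\theta},\mathbb Q)\le\lambda,\ \mathbb Q\in\mathcal P_{para}\},\delta)$, the choice $\mathbb P_{\hat\theta}$ can be strictly dominated by other distributions. That is, there exist a parametric family $\mathcal P_{para}=\{\mathbb P_\theta\}_{\theta\in\Theta}$, a member $\mathbb P_{\hat\theta}$, a $\phi$-divergence $d_\phi$, $\lambda>0$, $\delta\in(0,1)$ and a probability measure $\mathbb P_0$ such that $$M(\mathbb P_0,\{\mathbb Q\in\mathcal P_{para}: d_\phi(\mathbb P_{\hat\theta},\mathbb Q)\le\lambda\},\delta)<M(\mathbb P_{\hat\theta},\{\mathbb Q\in\mathcal P_{para}: d_\phi(\mathbb P_{\hat\theta},\mathbb Q)\le\lambda\},\delta).$$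
   Context: A parametric family $\{\mathbb P_\theta\}_{\theta\in\Theta}$, $\Theta\subset\mathbb R^D$, is a family of probability measures on a sample space $\mathcal Y$. A $\phi$-divergence is $d_\phi(\mathbb P_1,\mathbb P_2)=\int_{\mathcal Y}\phi(\frac{d\mathbb P_2}{d\mathbb P_1})d\mathbb P_1$ for $\mathbb P_2\ll\mathbb P_1$, where $\phi:\mathbb R_+\to\mathbb R_+$ is convex, $\phi(1)=0$, twice continuously differentiable with $\phi''(1)\neq0$ (for instance $\phi(x)=(x-1)^2$, the $\chi^2$-distance). For a probability measure $\mathbb P_0$, a set $\mathcal U$ of probability measures on $\mathcal Y$, and $\delta>0$, $$M(\mathbb P_0,\mathcal U,\delta)=\sup\{\mathbb Q(A):\ \mathbb Q\in\mathcal U,\ A\subset\mathcal Y\text{ measurable},\ \mathbb P_0(A)\le\delta\}.$$ *)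

theory Defs
  imports "HOL-Probability.Probability"
begin

text \<open>
  Only the values of \<open>\<phi>\<close> on \<open>{0..}\<close> matter. The derivatives are taken within \<open>{0..}\<close>,
  so they are one-sided at \<open>0\<close>.
\<close>

definition phi_function :: "(real \<Rightarrow> real) \<Rightarrow> bool" where
  "phi_function \<phi> \<longleftrightarrow>
     (\<forall>x\<ge>0. 0 \<le> \<phi> x) \<and> convex_on {0..} \<phi> \<and> \<phi> 1 = 0 \<and>
     (\<exists>\<phi>' \<phi>''.
        (\<forall>x\<ge>0. (\<phi> has_real_derivative \<phi>' x) (at x within {0..})) \<and>
        (\<forall>x\<ge>0. (\<phi>' has_real_derivative \<phi>'' x) (at x within {0..})) \<and>
        continuous_on {0..} \<phi>'' \<and> \<phi>'' 1 \<noteq> 0)"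

text \<open>
  The divergence is extended by \<open>\<infinity>\<close> to measures \<open>P2\<close> that are not absolutely continuous
  with respect to \<open>P1\<close>, so that these lie in no divergence ball around \<open>P1\<close>.
  For probability measures \<open>P1\<close>, \<open>P2\<close> with the same measurable sets and
  \<open>P2\<close> absolutely continuous, \<open>RN_deriv P1 P2\<close> is finite \<open>P1\<close>-almost everywhere,
  so \<open>enn2real\<close> loses nothing.
\<close>

definition phi_div :: "(real \<Rightarrow> real) \<Rightarrow> 'y measure \<Rightarrow> 'y measure \<Rightarrow> ennreal" where
  "phi_div \<phi> P1 P2 =
     (if absolutely_continuous P1 P2
      then \<integral>\<^sup>+ y. ennreal (\<phi> (enn2real (RN_deriv P1 P2 y))) \<partial>P1
      else \<infinity>)"

text \<open>The supremum is taken in \<^typ>\<open>ennreal\<close>, a complete lattice, so it needs no side conditions.\<close>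

definition worst_case_prob :: "'y measure \<Rightarrow> 'y measure set \<Rightarrow> real \<Rightarrow> ennreal" where
  "worst_case_prob P0 U \<delta> =
     Sup {emeasure Q A | Q A. Q \<in> U \<and> A \<in> sets P0 \<and> measure P0 A \<le> \<delta>}"

text \<open>
  \<open>\<real>\<^sup>D\<close> as the functions on \<open>{..<D}\<close>, so that the dimension is an ordinary natural number
  that can be quantified.
\<close>

definition real_vectors :: "nat \<Rightarrow> (nat \<Rightarrow> real) set" where
  "real_vectors D = ({..<D} \<rightarrow>\<^sub>E UNIV)"

text \<open>
  \<open>space (prob_algebra Y)\<close> is the set of all probability measures on the measurable space \<open>Y\<close>.
\<close>

definition parametric_family ::
    "'y measure \<Rightarrow> nat \<Rightarrow> (nat \<Rightarrow> real) set \<Rightarrow> ((nat \<Rightarrow> real) \<Rightarrow> 'y measure) \<Rightarrow> bool" where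
  "parametric_family Y D \<Theta> P \<longleftrightarrow>
     \<Theta> \<subseteq> real_vectors D \<and> (\<forall>\<theta>\<in>\<Theta>. P \<theta> \<in> space (prob_algebra Y))"

end

theory Submission imports Defs begin

text \<open>
  On a two-point space take the Bernoulli family with success probability \<open>p \<in> [1/2, 3/4]\<close>,
  the member \<open>p = 1/2\<close> and \<open>\<delta> = 1/2\<close>. The divergence ball is chosen so large that it contains
  \<open>p = 3/4\<close>. The success event has probability \<open>1/2\<close> under the centre, so it is
  admissible and its worst case is at least \<open>3/4\<close>. Generating from \<open>p = 3/4\<close> instead makes the
  success event inadmissible, and the remaining events have probability at most \<open>1/2\<close> under
  every member of the family.
\<close>

text \<open>\<open>of_bool\<close> moves success to 1 and failure to 0, since the sample space of
  the theorem consists of reals.\<close>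

definition bernoulli_real :: "real \<Rightarrow> real pmf" where
  "bernoulli_real p = map_pmf of_bool (bernoulli_pmf p)"

lemma measure_bernoulli_real:
  assumes "0 \<le> p" "p \<le> 1"
  shows "measure (bernoulli_real p) A = p * of_bool (1 \<in> A) + (1 - p) * of_bool (0 \<in> A)"
proof -
  have "measure (bernoulli_real p) A = measure_pmf.expectation (bernoulli_real p) (indicator A)"
    by simp
  also have "\<dots> = p * of_bool (1 \<in> A) + (1 - p) * of_bool (0 \<in> A)"
    unfolding bernoulli_real_def integral_map_pmf
    using assms by (subst integral_bernoulli_pmf) (auto simp: indicator_def)
  finally show ?thesis .
qed

lemma set_bernoulli_real:
  assumes "0 < p" "p < 1"
  shows "set_pmf (bernoulli_real p) = {0, 1}"
  using assms by (auto simp: bernoulli_real_def set_pmf_bernoulli UNIV_bool)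

lemma absolutely_continuous_measure_pmf:
  assumes "set_pmf q \<subseteq> set_pmf p"
  shows "absolutely_continuous (measure_pmf p) (measure_pmf q)"
  using assms
  by (auto simp: absolutely_continuous_def null_sets_def measure_pmf.emeasure_eq_measure
      measure_pmf_zero_iff)

text \<open>The support inclusion gives absolute continuity, so the divergence is an integral that
  reduces to a finite sum over the support of \<open>p\<close>, with each summand a real value times
  a probability.\<close>

lemma phi_div_measure_pmf_finite:
  assumes "finite (set_pmf p)" "set_pmf q \<subseteq> set_pmf p"
  shows "phi_div \<phi> (measure_pmf p) (measure_pmf q) < \<infinity>"
  using assms
  by (simp add: phi_div_def absolutely_continuous_measure_pmf nn_integral_measure_pmf_finite
      ennreal_mult_less_top)

lemma phi_function_chi_square: "phi_function (\<lambda>x. (x - 1)\<^sup>2)"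
proof -
  have "convex_on {0..} (\<lambda>x::real. (x - 1)\<^sup>2)"
    by (rule convex_on_realI[where f' = "\<lambda>x. 2 * (x - 1)"])
      (auto intro!: derivative_eq_intros)
  moreover have "((\<lambda>x. (x - 1)\<^sup>2) has_real_derivative 2 * (x - 1)) (at x within {0..})"
    and "((\<lambda>x. 2 * (x - 1)) has_real_derivative 2) (at x within {0..})" for x :: real
    by (auto intro!: derivative_eq_intros)
  ultimately show ?thesis
    unfolding phi_function_def
    by (intro conjI exI[of _ "\<lambda>x. 2 * (x - 1)"] exI[of _ "\<lambda>_. 2"]) auto
qed

theorem theorem3p3p1:
  "\<exists>(Y :: real measure) (D :: nat) (\<Theta> :: (nat \<Rightarrow> real) set) (P :: (nat \<Rightarrow> real) \<Rightarrow> real measure)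
      (\<theta>hat :: nat \<Rightarrow> real) (\<phi> :: real \<Rightarrow> real) (lam :: real) (\<delta> :: real) (P0 :: real measure).
     D \<ge> 1 \<and> parametric_family Y D \<Theta> P \<and> \<theta>hat \<in> \<Theta> \<and> phi_function \<phi> \<and>
     lam > 0 \<and> 0 < \<delta> \<and> \<delta> < 1 \<and> P0 \<in> space (prob_algebra Y) \<and>
     worst_case_prob P0 {Q \<in> P ` \<Theta>. phi_div \<phi> (P \<theta>hat) Q \<le> ennreal lam} \<delta>
       < worst_case_prob (P \<theta>hat) {Q \<in> P ` \<Theta>. phi_div \<phi> (P \<theta>hat) Q \<le> ennreal lam} \<delta>"
proof -
  define \<phi> :: "real \<Rightarrow> real" where "\<phi> = (\<lambda>x. (x - 1)\<^sup>2)"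
  \<comment> \<open>Restricting to \<open>{..<1}\<close> makes the function extensional, as
    membership in \<open>real_vectors 1\<close> demands.\<close>
  define vec :: "real \<Rightarrow> nat \<Rightarrow> real" where "vec p = (\<lambda>i\<in>{..<1}. p)" for p
  define P where "P \<theta> = measure_pmf (bernoulli_real (\<theta> 0))" for \<theta> :: "nat \<Rightarrow> real"
  define \<Theta> where "\<Theta> = vec ` {1/2..3/4}"
  define c where "c = phi_div \<phi> (P (vec (1/2))) (P (vec (3/4)))"
  define lam where "lam = enn2real c + 1"
  define U where "U = {Q \<in> P ` \<Theta>. phi_div \<phi> (P (vec (1/2))) Q \<le> ennreal lam}"
  have P_vec: "P (vec p) = measure_pmf (bernoulli_real p)" for p
    by (simp add: P_def vec_def)
  have prob: "measure_pmf q \<in> space (prob_algebra (count_space UNIV))" for q :: "real pmf"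
    by (simp add: space_prob_algebra measure_pmf.prob_space_axioms)
  have family: "parametric_family (count_space UNIV) 1 \<Theta> P"
    unfolding parametric_family_def
  proof (intro conjI ballI)
    show "\<Theta> \<subseteq> real_vectors 1"
      by (auto simp: \<Theta>_def vec_def real_vectors_def split: if_splits)
    show "P \<theta> \<in> space (prob_algebra (count_space UNIV))" for \<theta>
      unfolding P_def by (rule prob)
  qed
  \<comment> \<open>Finiteness matters because \<open>enn2real\<close> sends \<infinity> to 0: only
    for finite \<open>c\<close> does the radius \<open>lam\<close> dominate \<open>c\<close>. The
    added 1 in \<open>lam\<close> makes it positive.\<close>
  have "c < \<infinity>"
    unfolding c_def P_vec by (rule phi_div_measure_pmf_finite) (simp_all add: set_bernoulli_real)
  then have "c = ennreal (enn2real c)"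
    by simp
  also have "\<dots> \<le> ennreal lam"
    by (intro ennreal_leI) (simp add: lam_def)
  finally have mem: "P (vec (3/4)) \<in> U"
    by (simp add: U_def c_def \<Theta>_def)
  have "worst_case_prob (P (vec (3/4))) U (1/2) \<le> ennreal (1/2)"
    unfolding worst_case_prob_def
  proof (rule Sup_least, clarify)
    fix Q A assume "Q \<in> U" and A: "measure (P (vec (3/4))) A \<le> 1/2"
    then obtain p where p: "p \<in> {1/2..3/4}" and Q: "Q = measure_pmf (bernoulli_real p)"
      by (auto simp: U_def \<Theta>_def P_vec)
    \<comment> \<open>The point 1 alone already has mass 3/4 > 1/2 under this generator.\<close>
    have "1 \<notin> A"
      using A by (auto simp: P_vec measure_bernoulli_real split: split_of_bool_asm)
    \<comment> \<open>Without 1, the set has mass at most 1 - p, and the left end of the parameter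
      interval gives 1 - p \<le> 1/2.\<close>
    then have "measure Q A \<le> 1/2"
      using p by (simp add: Q measure_bernoulli_real)
    then show "emeasure Q A \<le> ennreal (1/2)"
      unfolding Q measure_pmf.emeasure_eq_measure by (rule ennreal_leI)
  qed
  also have "ennreal (1/2) < ennreal (3/4)"
    by (rule ennreal_lessI) simp_all
  also have "ennreal (3/4) = emeasure (P (vec (3/4))) {1}"
    by (simp add: P_vec measure_pmf.emeasure_eq_measure measure_bernoulli_real)
  \<comment> \<open>Under the centre the event \<open>{1}\<close> has mass exactly \<delta> = 1/2,
    which the non-strict constraint admits.\<close>
  also have "\<dots> \<le> worst_case_prob (P (vec (1/2))) U (1/2)"
    unfolding worst_case_prob_def using mem
    by (intro Sup_upper CollectI exI[of _ "P (vec (3/4))"] exI[of _ "{1}"])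
      (simp add: P_vec measure_bernoulli_real)
  finally have less: "worst_case_prob (P (vec (3/4))) U (1/2)
      < worst_case_prob (P (vec (1/2))) U (1/2)" .
  have "phi_function \<phi>"
    unfolding \<phi>_def by (rule phi_function_chi_square)
  moreover have "lam > 0"
    by (simp add: lam_def add_nonneg_pos)
  moreover have "vec (1/2) \<in> \<Theta>"
    by (simp add: \<Theta>_def)
  moreover have "P (vec (3/4)) \<in> space (prob_algebra (count_space UNIV))"
    unfolding P_vec by (rule prob)
  ultimately show ?thesis
    using family less unfolding U_def
    by (intro exI[of _ "count_space UNIV"] exI[of _ "1::nat"] exI[of _ \<Theta>] exI[of _ P]
        exI[of _ "vec (1/2)"] exI[of _ \<phi>] exI[of _ lam] exI[of _ "1/2"]
        exI[of _ "P (vec (3/4))"]) simp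
qed

end
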